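(* There exist a real analytic planar 3-web $W$ and a point $M$ of its domain such that $W$ is non-flat near $M$ and $W$ has a circular symmetry around $M$.
   Context: A planar 3-web is a triple of 1-dimensional, mutually transversal (real analytic) foliations on an open domain of the plane. A symmetry of $W$ around $M$ is a (germ at $M$ of an analytic) local diffeomorphism of the plane which fixes $M$ and maps each foliation of $W$ to a (possibly different) foliation of $W$. A circular symmetry is a symmetry which permutes the three foliations circularly (i.e. by a 3-cycle). $W$ is flat near $M$ if there are local coordinates $(x,y)$ near $M$, vanishing at $M$, in which its three foliations are $\{x=\text{constant}\}$, $\{y=\text{constant}\}$ and $\{x+y=\text{constant}\}$; otherwise it is non-flat near $M$. *)

theory Defs
  imports "HOL-Analysis.Analysis" "HOL-Combinatorics.Cycles"
begin

type_synonym plane = "real \<times> real"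

definition real_analytic_on :: "(plane \<Rightarrow> real) \<Rightarrow> plane set \<Rightarrow> bool" where
  "real_analytic_on f S \<longleftrightarrow>
    (\<forall>(a, b) \<in> S. \<exists>(c :: nat \<Rightarrow> nat \<Rightarrow> real) r. r > 0 \<and>
      (\<forall>x y. \<bar>x - a\<bar> < r \<longrightarrow> \<bar>y - b\<bar> < r \<longrightarrow>
        ((\<lambda>(i, j). c i j * (x - a) ^ i * (y - b) ^ j) has_sum f (x, y)) UNIV))"

definition analytic_diffeo :: "plane set \<Rightarrow> plane set \<Rightarrow> (plane \<Rightarrow> plane) \<Rightarrow> bool" where
  "analytic_diffeo A B g \<longleftrightarrow>
    open A \<and> open B \<and> bij_betw g A B \<and>
    real_analytic_on (fst \<circ> g) A \<and> real_analytic_on (snd \<circ> g) A \<and>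
    real_analytic_on (fst \<circ> inv_into A g) B \<and> real_analytic_on (snd \<circ> inv_into A g) B"

definition analytic_submersion_on :: "(plane \<Rightarrow> real) \<Rightarrow> plane set \<Rightarrow> bool" where
  "analytic_submersion_on u V \<longleftrightarrow>
    real_analytic_on u V \<and> (\<forall>p\<in>V. surj (frechet_derivative u (at p)))"

text \<open>
  The level sets of \<open>u\<close> and \<open>v\<close> coincide on a neighbourhood of \<open>p\<close>.  For analytic submersions
  this says that \<open>v = h \<circ> u\<close> near \<open>p\<close> for some analytic diffeomorphism \<open>h\<close> between intervals.
\<close>
definition same_levels_near :: "plane \<Rightarrow> (plane \<Rightarrow> real) \<Rightarrow> (plane \<Rightarrow> real) \<Rightarrow> bool" where
  "same_levels_near p u v \<longleftrightarrow>
    (\<exists>N. open N \<and> p \<in> N \<and> (\<forall>q\<in>N. \<forall>q'\<in>N. u q = u q' \<longleftrightarrow> v q = v q'))"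

text \<open>
  A one-dimensional foliation is given by a foliated atlas: a cover by open sets \<open>V\<close> carrying
  distinguished submersions \<open>u\<close>, whose level sets in \<open>V\<close> are (locally) the leaves, and which agree
  on overlaps.  Two atlases define the same foliation near a point iff their distinguished
  submersions there have the same level sets, so foliations are only compared via
  \<open>level_foliation_near\<close> below, never by equality of atlases.
\<close>
type_synonym foliation = "(plane set \<times> (plane \<Rightarrow> real)) set"

definition analytic_foliation :: "plane set \<Rightarrow> foliation \<Rightarrow> bool" where
  "analytic_foliation U F \<longleftrightarrow>
    (\<Union>(V, u)\<in>F. V) = U \<and>
    (\<forall>(V, u)\<in>F. open V \<and> analytic_submersion_on u V) \<and>
    (\<forall>(V, u)\<in>F. \<forall>(V', u')\<in>F. \<forall>p \<in> V \<inter> V'. same_levels_near p u u')"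

text \<open>Near \<open>p\<close>, the foliation \<open>F\<close> is \<open>{w = constant}\<close>.\<close>
definition level_foliation_near :: "plane \<Rightarrow> foliation \<Rightarrow> (plane \<Rightarrow> real) \<Rightarrow> bool" where
  "level_foliation_near p F w \<longleftrightarrow> (\<exists>(V, u)\<in>F. p \<in> V \<and> same_levels_near p u w)"

text \<open>Transversality: the tangent lines (kernels of the differentials) meet only in \<open>0\<close>.\<close>
definition transversal_on :: "plane set \<Rightarrow> foliation \<Rightarrow> foliation \<Rightarrow> bool" where
  "transversal_on U F G \<longleftrightarrow>
    (\<forall>p\<in>U. \<forall>(V, u)\<in>F. \<forall>(V', v)\<in>G. p \<in> V \<inter> V' \<longrightarrow>
      {w. frechet_derivative u (at p) w = 0} \<inter> {w. frechet_derivative v (at p) w = 0} = {0})"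

definition planar_3web :: "plane set \<Rightarrow> (3 \<Rightarrow> foliation) \<Rightarrow> bool" where
  "planar_3web U W \<longleftrightarrow>
    open U \<and> connected U \<and> U \<noteq> {} \<and>
    (\<forall>i. analytic_foliation U (W i)) \<and>
    (\<forall>i j. i \<noteq> j \<longrightarrow> transversal_on U (W i) (W j))"

text \<open>
  The assignment of the three foliations to \<open>x\<close>, \<open>y\<close> and \<open>x + y\<close> is arbitrary.
\<close>
definition flat_near :: "plane \<Rightarrow> (3 \<Rightarrow> foliation) \<Rightarrow> bool" where
  "flat_near M W \<longleftrightarrow>
    (\<exists>A B \<phi> i j k. M \<in> A \<and> analytic_diffeo A B \<phi> \<and> \<phi> M = (0, 0) \<and> distinct [i, j, k] \<and>
      level_foliation_near M (W i) (\<lambda>p. fst (\<phi> p)) \<and>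
      level_foliation_near M (W j) (\<lambda>p. snd (\<phi> p)) \<and>
      level_foliation_near M (W k) (\<lambda>p. fst (\<phi> p) + snd (\<phi> p)))"

text \<open>
  A local diffeomorphism \<open>g\<close> maps \<open>F\<close> near \<open>p\<close> to \<open>G\<close> near \<open>g p\<close> iff the pullback of a
  distinguished submersion of \<open>G\<close> defines \<open>F\<close>.
\<close>
definition maps_foliation_near :: "plane \<Rightarrow> (plane \<Rightarrow> plane) \<Rightarrow> foliation \<Rightarrow> foliation \<Rightarrow> bool" where
  "maps_foliation_near p g F G \<longleftrightarrow>
    (\<exists>(V, v)\<in>G. g p \<in> V \<and> level_foliation_near p F (v \<circ> g))"

definition symmetry_around :: "plane \<Rightarrow> (3 \<Rightarrow> foliation) \<Rightarrow> (plane \<Rightarrow> plane) \<Rightarrow> bool" where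
  "symmetry_around M W g \<longleftrightarrow>
    (\<exists>A B. M \<in> A \<and> analytic_diffeo A B g) \<and> g M = M \<and>
    (\<forall>i. \<exists>j. maps_foliation_near M g (W i) (W j))"

definition circular_symmetry_around :: "plane \<Rightarrow> (3 \<Rightarrow> foliation) \<Rightarrow> (plane \<Rightarrow> plane) \<Rightarrow> bool" where
  "circular_symmetry_around M W g \<longleftrightarrow>
    symmetry_around M W g \<and>
    (\<exists>cs. cycle cs \<and> length cs = 3 \<and>
      (\<forall>i. maps_foliation_near M g (W i) (W (cycle_of_list cs i))))"

end

theory Submission
  imports Defs
begin

text \<open>
  On the plane \<open>x + y + z = 0\<close> take the web with first integrals \<open>x + Q\<close>, \<open>y + Q\<close>, \<open>z + Q\<close>, where
  the cubic \<open>Q\<close> is proportional to \<open>(x - y) (y - z) (z - x)\<close>.  The polynomial \<open>Q\<close> is invariant under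
  the cyclic shift \<open>(x, y, z) \<mapsto> (y, z, x)\<close>, so that shift is a circular symmetry fixing the origin.
  In a flat web every small hexagon around the origin closes.  Here the shift reduces the
  six steps along such a hexagon to six iterations of a single map \<open>a \<mapsto> b\<close>, given by
  \<open>a + b = a b (b - a)\<close>.  This map strictly decreases \<open>\<bar>a\<bar>\<close>, so hexagons do not close.
\<close>

text \<open>
  Up to the factor 3, the coordinates are \<open>s = x - z\<close> and \<open>t = y - z\<close>; on the leaf \<open>z + Q = 0\<close> the
  other two first integrals are then just \<open>3 s\<close> and \<open>3 t\<close>.
\<close>

definition cubic :: "real \<Rightarrow> real \<Rightarrow> real \<Rightarrow> plane \<Rightarrow> real" where
  "cubic \<alpha> \<beta> \<gamma> = (\<lambda>(s, t). \<alpha> * s + \<beta> * t + \<gamma> * (s * t^2 - s^2 * t))"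

text \<open>In these coordinates \<open>x = 2 * s - t\<close>, \<open>y = 2 * t - s\<close>,
  \<open>z = - s - t\<close>, and Q is normalised to \<open>s * t * (t - s)\<close>.\<close>

definition first_integral :: "3 \<Rightarrow> plane \<Rightarrow> real" where
  "first_integral i =
    (if i = 1 then cubic 2 (-1) 1 else if i = 2 then cubic (-1) 2 1 else cubic (-1) (-1) 1)"

text \<open>The cyclic shift turns \<open>s = (x - z) / 3\<close> into \<open>(y - x) / 3\<close>
  and \<open>t = (y - z) / 3\<close> into \<open>(z - x) / 3\<close>.\<close>

definition shift :: "plane \<Rightarrow> plane" where
  "shift = (\<lambda>(s, t). (t - s, - s))"

definition square :: "plane set" where
  "square = {-1/2<..<1/2} \<times> {-1/2<..<1/2}"

definition web :: "3 \<Rightarrow> foliation" where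
  "web i = {(square, first_integral i)}"

section \<open>Analyticity of polynomials\<close>

text \<open>A finite Taylor expansion about each point, padded with zero coefficients, is a
  convergent power series there.\<close>

lemma real_analytic_on_finite_expansion:
  fixes f :: "plane \<Rightarrow> real"
  assumes "\<And>a b. \<exists>c. \<forall>x y. f (x, y) = (\<Sum>i<n. \<Sum>j<m. c i j * (x - a)^i * (y - b)^j)"
  shows "real_analytic_on f S"
  unfolding real_analytic_on_def
proof clarify
  fix a b
  obtain c where c: "\<And>x y. f (x, y) = (\<Sum>i<n. \<Sum>j<m. c i j * (x - a)^i * (y - b)^j)"
    using assms by blast
  let ?c = "\<lambda>i j. if i < n \<and> j < m then c i j else 0"
  have "((\<lambda>(i, j). ?c i j * (x - a)^i * (y - b)^j) has_sum f (x, y)) UNIV" for x y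
  proof -
    have "((\<lambda>(i, j). ?c i j * (x - a)^i * (y - b)^j) has_sum
        (\<Sum>(i, j)\<in>{..<n} \<times> {..<m}. ?c i j * (x - a)^i * (y - b)^j)) ({..<n} \<times> {..<m})"
      by (intro has_sum_finite) auto
    moreover have "(\<Sum>(i, j)\<in>{..<n} \<times> {..<m}. ?c i j * (x - a)^i * (y - b)^j) = f (x, y)"
      by (simp add: c flip: sum.cartesian_product)
    ultimately show ?thesis
      by (subst has_sum_cong_neutral[where T = "{..<n} \<times> {..<m}"]) (auto split: if_splits)
  qed
  then show "\<exists>c r. r > 0 \<and> (\<forall>x y. \<bar>x - a\<bar> < r \<longrightarrow> \<bar>y - b\<bar> < r \<longrightarrow>
        ((\<lambda>(i, j). c i j * (x - a) ^ i * (y - b) ^ j) has_sum f (x, y)) UNIV)"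
    by (intro exI[of _ ?c] exI[of _ 1]) simp
qed

lemma real_analytic_on_cubic: "real_analytic_on (cubic \<alpha> \<beta> \<gamma>) S"
proof (rule real_analytic_on_finite_expansion[where n = 3 and m = 3])
  fix a b :: real
  \<comment> \<open>Row \<open>i\<close>, column \<open>j\<close> holds the Taylor coefficient at
    \<open>(a, b)\<close>; the degree in each variable is at most 2.\<close>
  let ?c = "\<lambda>i j :: nat. (
    [[cubic \<alpha> \<beta> \<gamma> (a, b), \<beta> + \<gamma> * (2 * a * b - a^2), \<gamma> * a],
     [\<alpha> + \<gamma> * (b^2 - 2 * a * b), \<gamma> * (2 * b - 2 * a), \<gamma>],
     [- \<gamma> * b, - \<gamma>, 0]]) ! i ! j"
  have "cubic \<alpha> \<beta> \<gamma> (x, y) = (\<Sum>i<3. \<Sum>j<3. ?c i j * (x - a)^i * (y - b)^j)" for x y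
    by (simp add: cubic_def numeral_3_eq_3) (simp add: power2_eq_square algebra_simps)
  then show "\<exists>c. \<forall>x y. cubic \<alpha> \<beta> \<gamma> (x, y) = (\<Sum>i<3. \<Sum>j<3. c i j * (x - a)^i * (y - b)^j)"
    by (intro exI[of _ ?c]) blast
qed

section \<open>Differentials and transversality\<close>

lemma frechet_derivative_cubic:
  "frechet_derivative (cubic \<alpha> \<beta> \<gamma>) (at (s, t)) =
    (\<lambda>h. (\<alpha> + \<gamma> * (t^2 - 2 * s * t)) * fst h + (\<beta> + \<gamma> * (2 * s * t - s^2)) * snd h)"
proof -
  have "cubic \<alpha> \<beta> \<gamma> = (\<lambda>p. \<alpha> * fst p + \<beta> * snd p + \<gamma> * (fst p * snd p^2 - fst p^2 * snd p))"
    by (simp add: cubic_def fun_eq_iff)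
  moreover have "((\<lambda>p. \<alpha> * fst p + \<beta> * snd p + \<gamma> * (fst p * snd p^2 - fst p^2 * snd p))
      has_derivative
      (\<lambda>h. (\<alpha> + \<gamma> * (t^2 - 2 * s * t)) * fst h + (\<beta> + \<gamma> * (2 * s * t - s^2)) * snd h)) (at (s, t))"
    by (auto intro!: derivative_eq_intros simp: fun_eq_iff power2_eq_square algebra_simps)
  ultimately show ?thesis
    by (simp only: frechet_derivative_at[symmetric])
qed

lemma surj_linear_form:
  fixes A B :: real
  assumes "A \<noteq> 0 \<or> B \<noteq> 0"
  shows "surj (\<lambda>h :: plane. A * fst h + B * snd h)"
proof (rule surjI)
  fix c
  show "(\<lambda>h. A * fst h + B * snd h) (if A \<noteq> 0 then (c / A, 0) else (0, c / B)) = c"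
    using assms by auto
qed

text \<open>Cramer's rule.\<close>

lemma linear_forms_kernel:
  fixes A B C D :: real
  assumes "A * D - B * C \<noteq> 0"
  shows "{h :: plane. A * fst h + B * snd h = 0} \<inter> {h. C * fst h + D * snd h = 0} = {0}"
proof -
  have "h = 0" if "A * fst h + B * snd h = 0" "C * fst h + D * snd h = 0" for h :: plane
  proof -
    have "(A * D - B * C) * fst h = D * (A * fst h + B * snd h) - B * (C * fst h + D * snd h)"
      and "(A * D - B * C) * snd h = A * (C * fst h + D * snd h) - C * (A * fst h + B * snd h)"
      by algebra+
    then have "(A * D - B * C) * fst h = 0" "(A * D - B * C) * snd h = 0"
      unfolding that by simp_all
    then show ?thesis
      using assms by (simp add: prod_eq_iff)
  qed
  then have "{h :: plane. A * fst h + B * snd h = 0} \<inter> {h. C * fst h + D * snd h = 0} \<subseteq> {0}"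
    by blast
  then show ?thesis
    by (intro subset_antisym) simp_all
qed

text \<open>The three quantities are the partial derivatives of Q and the negative of their sum.
  Each transversality determinant of the web vanishes only where one of them equals 1.\<close>

lemma square_bounds:
  assumes "(s, t) \<in> square"
  shows "t^2 - 2 * s * t < 1" "2 * s * t - s^2 < 1" "s^2 - t^2 < 1"
proof -
  have "\<bar>s\<bar> < 1/2" "\<bar>t\<bar> < 1/2"
    using assms by (auto simp: square_def abs_less_iff)
  then have "\<bar>s\<bar> * \<bar>t\<bar> < 1/2 * (1/2)" "\<bar>s\<bar>^2 < (1/2)^2" "\<bar>t\<bar>^2 < (1/2)^2"
    by (intro abs_mult_less power_strict_mono; simp)+
  then have "\<bar>s * t\<bar> < 1/4" "s^2 < 1/4" "t^2 < 1/4"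
    by (simp_all add: abs_mult power2_eq_square)
  then show "t^2 - 2 * s * t < 1" "2 * s * t - s^2 < 1" "s^2 - t^2 < 1"
    using zero_le_power2[of s] zero_le_power2[of t] unfolding mult.assoc abs_less_iff by linarith+
qed

lemma first_integral_3 [simp]:
  "first_integral 1 = cubic 2 (-1) 1" "first_integral 2 = cubic (-1) 2 1"
  "first_integral 3 = cubic (-1) (-1) 1"
  by (simp_all add: first_integral_def)

lemma transversal_web:
  assumes "i \<noteq> j"
  shows "transversal_on square (web i) (web j)"
proof -
  have "{w. frechet_derivative (first_integral i) (at (s, t)) w = 0} \<inter>
      {w. frechet_derivative (first_integral j) (at (s, t)) w = 0} = {0}"
    if "(s, t) \<in> square" for s t
  proof -
    let ?Qs = "t^2 - 2 * s * t" and ?Qt = "2 * s * t - s^2"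
    have *: "?Qs < 1" "?Qt < 1" "?Qs + ?Qt > -1"
      using square_bounds[OF that] by auto
    \<comment> \<open>Here \<open>p\<close> and \<open>q\<close> stand for the partial derivatives
      of Q; the determinants belong to the pairs 1-2, 1-3 and 2-3.\<close>
    have dets: "(2 + p) * (2 + q) - (-1 + q) * (-1 + p) \<noteq> 0"
      "(2 + p) * (-1 + q) - (-1 + q) * (-1 + p) \<noteq> 0"
      "(-1 + p) * (-1 + q) - (2 + q) * (-1 + p) \<noteq> 0"
      if "p < 1" "q < 1" "p + q > -1" for p q :: real
    proof -
      have "(2 + p) * (2 + q) - (-1 + q) * (-1 + p) = 3 * (1 + p + q)"
        "(2 + p) * (-1 + q) - (-1 + q) * (-1 + p) = 3 * (-1 + q)"
        "(-1 + p) * (-1 + q) - (2 + q) * (-1 + p) = -3 * (-1 + p)"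
        by algebra+
      then show "(2 + p) * (2 + q) - (-1 + q) * (-1 + p) \<noteq> 0"
        "(2 + p) * (-1 + q) - (-1 + q) * (-1 + p) \<noteq> 0"
        "(-1 + p) * (-1 + q) - (2 + q) * (-1 + p) \<noteq> 0"
        using that by (simp_all only:) auto
    qed
    note kernels = dets[OF *, THEN linear_forms_kernel]
    define K where "K l = {w. frechet_derivative (first_integral l) (at (s, t)) w = 0}" for l
    have "K 1 \<inter> K 2 = {0}" "K 1 \<inter> K 3 = {0}" "K 2 \<inter> K 3 = {0}"
      using kernels by (simp_all only: K_def first_integral_3 frechet_derivative_cubic mult_1)
    then show ?thesis
      using assms exhaust_3[of i] exhaust_3[of j] unfolding K_def[symmetric]
      by (elim disjE; simp add: Int_commute)
  qed
  then show ?thesis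
    by (auto simp: transversal_on_def web_def)
qed

lemma analytic_submersion_first_integral: "analytic_submersion_on (first_integral i) square"
proof -
  have "surj (frechet_derivative (first_integral i) (at (s, t)))" if "(s, t) \<in> square" for s t
    \<comment> \<open>Each differential has a coefficient \<open>-1 + p\<close> or
      \<open>-1 + q\<close>, with \<open>p\<close>, \<open>q\<close> the partial derivatives of Q,
      and both of these are negative.\<close>
    using exhaust_3[of i] square_bounds[OF that]
    by (elim disjE; simp only: first_integral_3 frechet_derivative_cubic;
        intro surj_linear_form; auto)
  moreover have "real_analytic_on (first_integral i) square"
    by (simp add: first_integral_def real_analytic_on_cubic)
  ultimately show ?thesis
    by (auto simp: analytic_submersion_on_def)
qed

lemma same_levels_near_refl [simp]: "same_levels_near p u u"
  unfolding same_levels_near_def by (intro exI[of _ UNIV]) simp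

lemma open_square: "open square" and connected_square: "connected square" and zero_in_square: "(0, 0) \<in> square"
  unfolding square_def by (auto intro!: open_Times convex_connected convex_Times)

lemma planar_3web_web: "planar_3web square web"
  unfolding planar_3web_def analytic_foliation_def
  using open_square connected_square zero_in_square transversal_web analytic_submersion_first_integral
  by (auto simp: web_def)

section \<open>The circular symmetry\<close>

lemma first_integral_shift:
  "first_integral 1 \<circ> shift = first_integral 2"
  "first_integral 2 \<circ> shift = first_integral 3"
  "first_integral 3 \<circ> shift = first_integral 1"
  by (auto simp: fun_eq_iff cubic_def shift_def power2_eq_square algebra_simps)

lemma analytic_diffeo_shift: "analytic_diffeo UNIV UNIV shift"
proof -
  have inv: "inv shift = (\<lambda>(s, t). (- t, s - t))"
    by (rule inv_equality) (auto simp: shift_def)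
  have "bij shift"
    by (rule o_bij[of "\<lambda>(s, t). (- t, s - t)"]) (auto simp: shift_def)
  \<comment> \<open>With \<gamma> = 0 the cubic is a linear form, so its analyticity covers linear
    maps too.\<close>
  moreover have "fst \<circ> shift = cubic (-1) 1 0" "snd \<circ> shift = cubic (-1) 0 0"
    "fst \<circ> inv shift = cubic 0 (-1) 0" "snd \<circ> inv shift = cubic 1 (-1) 0"
    unfolding inv by (auto simp: fun_eq_iff cubic_def shift_def)
  ultimately show ?thesis
    by (simp add: analytic_diffeo_def real_analytic_on_cubic)
qed

lemma circular_symmetry_shift: "circular_symmetry_around (0, 0) web shift"
proof -
  \<comment> \<open>Foliations are mapped by pulling back the target's first integral, so
    \<open>first_integral 1 \<circ> shift = first_integral 2\<close> sends foliation 2 to foliation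
    1. This reverses the order of the cycle.\<close>
  have "maps_foliation_near (0, 0) shift (web i) (web (cycle_of_list [1, 3, 2] i))" for i
    using exhaust_3[of i] zero_in_square first_integral_shift
    by (auto simp: maps_foliation_near_def level_foliation_near_def web_def shift_def
        simp del: first_integral_3)
  moreover have "cycle [1, 3, 2 :: 3]"
    by simp
  moreover have "shift (0, 0) = (0, 0)"
    by (simp add: shift_def)
  ultimately show ?thesis
    unfolding circular_symmetry_around_def symmetry_around_def
    using analytic_diffeo_shift by (metis UNIV_I length_Cons list.size(3) numeral_3_eq_3)
qed

section \<open>Non-flatness by failure of hexagon closure\<close>

text \<open>Negating the third flat integral keeps its level sets and turns flatness into a relation
  symmetric in the three foliations, so their unknown order drops out.\<close>

lemma flat_near_webE:
  assumes "flat_near (0, 0) web"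
  obtains f :: "3 \<Rightarrow> plane \<Rightarrow> real" where "\<And>p. f 1 p + f 2 p + f 3 p = 0"
    "\<And>i. same_levels_near (0, 0) (first_integral i) (f i)"
proof -
  obtain \<phi> i j k where "distinct [i, j, k]" and levels:
      "same_levels_near (0, 0) (first_integral i) (\<lambda>p. fst (\<phi> p))"
      "same_levels_near (0, 0) (first_integral j) (\<lambda>p. snd (\<phi> p))"
      "same_levels_near (0, 0) (first_integral k) (\<lambda>p. fst (\<phi> p) + snd (\<phi> p))"
    using assms unfolding flat_near_def level_foliation_near_def web_def by auto
  then have dist: "i \<noteq> j" "i \<noteq> k" "j \<noteq> k"
    by auto
  define f where "f l p = (if l = i then fst (\<phi> p) else if l = j then snd (\<phi> p)
    else - (fst (\<phi> p) + snd (\<phi> p)))" for l :: 3 and p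
  have UNIV: "UNIV = {i, j, k}"
    using dist by (intro card_seteq[symmetric]) auto
  show thesis
  proof
    fix p
    have "f 1 p + f 2 p + f 3 p = (\<Sum>l\<in>UNIV. f l p)"
      by (simp add: sum_3)
    also have "\<dots> = 0"
      using dist unfolding UNIV by (simp add: f_def)
    finally show "f 1 p + f 2 p + f 3 p = 0" .
  next
    fix l
    have "same_levels_near (0, 0) (first_integral k) (\<lambda>p. - (fst (\<phi> p) + snd (\<phi> p)))"
      using levels(3) unfolding same_levels_near_def neg_equal_iff_equal .
    moreover have "f i = (\<lambda>p. fst (\<phi> p))" "f j = (\<lambda>p. snd (\<phi> p))"
      "f k = (\<lambda>p. - (fst (\<phi> p) + snd (\<phi> p)))"
      using dist by (auto simp: f_def)
    moreover have "l = i \<or> l = j \<or> l = k"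
      using UNIV by blast
    ultimately show "same_levels_near (0, 0) (first_integral l) (f l)"
      using levels by (elim disjE) (simp_all only:)
  qed
qed

text \<open>The equation puts \<open>(a, b)\<close> on the third leaf through the origin. For
  \<open>a > 0\<close> the difference of its sides is \<open>-2 * a^3\<close> at
  \<open>b = -a\<close> and \<open>a\<close> at \<open>b = 0\<close>, so a root lies strictly
  between. The equation is odd under \<open>(a, b) \<mapsto> (-a, -b)\<close>, which settles
  \<open>a < 0\<close>.\<close>

lemma holonomy_step:
  fixes a :: real
  assumes "a \<noteq> 0"
  shows "\<exists>b. b \<noteq> 0 \<and> \<bar>b\<bar> < \<bar>a\<bar> \<and> a + b = a * b * (b - a)"
proof -
  have pos: "\<exists>b. b \<noteq> 0 \<and> \<bar>b\<bar> < \<bar>a\<bar> \<and> a + b = a * b * (b - a)" if "a > 0" for a :: real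
  proof -
    let ?F = "\<lambda>b. a + b - a * b * (b - a)"
    have ends: "?F (- a) < 0" "?F 0 > 0"
      using that by (auto simp: mult_neg_pos)
    moreover have "continuous_on {-a..0} ?F"
      by (intro continuous_intros)
    ultimately obtain b where b: "-a \<le> b" "b \<le> 0" "?F b = 0"
      using IVT'[of ?F "-a" 0 0] that by auto
    with ends have "b \<noteq> - a" "b \<noteq> 0"
      by auto
    with b that show ?thesis
      by (intro exI[of _ b]) auto
  qed
  show ?thesis
  proof (cases "a > 0")
    case True
    then show ?thesis by (rule pos)
  next
    case False
    then obtain b where "b \<noteq> 0" "\<bar>b\<bar> < \<bar>- a\<bar>" "- a + b = - a * b * (b - - a)"
      using pos[of "- a"] assms by auto
    then show ?thesis
      by (intro exI[of _ "- b"]) (auto simp: algebra_simps)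
  qed
qed

lemma not_flat_web: "\<not> flat_near (0, 0) web"
proof
  assume "flat_near (0, 0) web"
  then obtain f where sum: "\<And>p. f 1 p + f 2 p + f 3 p = 0"
    and "\<And>i. same_levels_near (0, 0) (first_integral i) (f i)"
    by (rule flat_near_webE) blast
  then have "\<forall>i. \<exists>N. open N \<and> (0, 0) \<in> N \<and>
      (\<forall>q\<in>N. \<forall>q'\<in>N. first_integral i q = first_integral i q' \<longleftrightarrow> f i q = f i q')"
    by (simp add: same_levels_near_def)
  then obtain N where N: "\<And>i. open (N i)" "\<And>i. (0, 0) \<in> N i" and levels:
    "\<And>i q q'. q \<in> N i \<Longrightarrow> q' \<in> N i \<Longrightarrow> first_integral i q = first_integral i q' \<longleftrightarrow> f i q = f i q'"
    by metis
  let ?N = "\<Inter>i. N i"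
  have "open ?N" "(0, 0) \<in> ?N"
    using N by auto
  then obtain e where "e > 0" "ball (0, 0) e \<subseteq> ?N"
    using open_contains_ball by meson
  have near: "(s, t) \<in> ?N" if "\<bar>s\<bar> \<le> e / 4" "\<bar>t\<bar> \<le> e / 4" for s t
  proof -
    have "dist (0, 0) (s, t) \<le> \<bar>s\<bar> + \<bar>t\<bar>"
      by (simp add: dist_Pair_Pair dist_real_def sqrt_sum_squares_le_sum_abs)
    then have "(s, t) \<in> ball (0, 0) e"
      using that \<open>e > 0\<close> by simp
    then show ?thesis
      using \<open>ball (0, 0) e \<subseteq> ?N\<close> by blast
  qed
  have "\<forall>a :: real. \<exists>b. a \<noteq> 0 \<longrightarrow> b \<noteq> 0 \<and> \<bar>b\<bar> < \<bar>a\<bar> \<and> a + b = a * b * (b - a)"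
    using holonomy_step by blast
  then obtain \<sigma> where
    "\<forall>a :: real. a \<noteq> 0 \<longrightarrow> \<sigma> a \<noteq> 0 \<and> \<bar>\<sigma> a\<bar> < \<bar>a\<bar> \<and> a + \<sigma> a = a * \<sigma> a * (\<sigma> a - a)"
    by (rule choice[THEN exE])
  then have \<sigma>: "\<sigma> a \<noteq> 0 \<and> \<bar>\<sigma> a\<bar> < \<bar>a\<bar> \<and> a + \<sigma> a = a * \<sigma> a * (\<sigma> a - a)" if "a \<noteq> 0" for a
    using that by blast
  \<comment> \<open>Both shifts involve differences of two terms; terms of size at most
    \<open>e / 8\<close> keep all coordinates within the \<open>e / 4\<close> of
    \<open>near\<close>.\<close>
  define a where "a n = (\<sigma> ^^ n) (e / 8)" for n
  have nz: "a n \<noteq> 0" for n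
    using \<open>e > 0\<close> \<sigma> by (induction n) (auto simp: a_def)
  have step: "\<bar>a (Suc n)\<bar> < \<bar>a n\<bar>" "a n + a (Suc n) = a n * a (Suc n) * (a (Suc n) - a n)" for n
    using \<sigma>[OF nz[of n]] by (simp_all add: a_def)
  have small: "\<bar>a n\<bar> \<le> e / 8" for n
  proof (induction n)
    case 0
    then show ?case
      using \<open>e > 0\<close> by (simp add: a_def)
  next
    case (Suc n)
    then show ?case
      using step(1)[of n] by linarith
  qed
  have in_N: "(a n, a (Suc n)) \<in> ?N" "shift (a n, a (Suc n)) \<in> ?N"
    "shift (shift (a n, a (Suc n))) \<in> ?N" for n
    using small[of n] small[of "Suc n"] unfolding shift_def prod.case by (intro near; linarith)+
  have R: "first_integral 1 (a n, a (Suc n)) = 3 * a n"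
    "first_integral 2 (a n, a (Suc n)) = 3 * a (Suc n)"
    "first_integral 3 (a n, a (Suc n)) = 0" for n
    using step(2)[of n] by (simp_all add: cubic_def power2_eq_square algebra_simps)
  note shifts = first_integral_shift[THEN fun_cong, unfolded comp_apply]
  let ?P = "\<lambda>n. (a n, a (Suc n))"
  have origin: "first_integral i (0, 0) = 0" for i
    by (simp add: first_integral_def cubic_def)
  have origin_in: "(0, 0) \<in> ?N"
    using N by blast
  \<comment> \<open>Half a hexagon acts on the first leaf parameter as the central symmetry of a flat web.\<close>
  have half: "f 1 (?P (n + 3)) = 2 * f 1 (0, 0) - f 1 (?P n)" for n
  proof -
    \<comment> \<open>Consecutive hexagon vertices, each on a leaf through the origin: of foliation
      3, 1 and 2 respectively. \<open>?A\<close> and \<open>?B\<close> share a leaf of foliation 2,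
      \<open>?B\<close> and \<open>?C\<close> one of foliation 3, \<open>?C\<close> and
      \<open>?P (n + 3)\<close> one of foliation 1.\<close>
    let ?A = "?P n" and ?B = "shift (shift (?P (n + 1)))" and ?C = "shift (?P (n + 2))"
    have eq: "f i p = f i q" if "first_integral i p = first_integral i q" "p \<in> ?N" "q \<in> ?N" for i p q
      using that levels by blast
    have "f 3 ?A = f 3 (0, 0)" "f 1 ?B = f 1 (0, 0)" "f 2 ?C = f 2 (0, 0)"
      "f 2 ?A = f 2 ?B" "f 3 ?B = f 3 ?C" "f 1 ?C = f 1 (?P (n + 3))"
      by (rule eq; (intro in_N origin_in)?;
          simp only: shifts R origin add_Suc_right add_0_right numeral_2_eq_2 numeral_3_eq_3 One_nat_def)+
    then show ?thesis
      using sum[of ?A] sum[of ?B] sum[of ?C] sum[of "(0, 0)"] by linarith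
  qed
  \<comment> \<open>A central symmetry applied twice is the identity, so flatness would close the
    hexagon after six steps.\<close>
  from half[of 0] half[of 3] have "f 1 (?P 6) = f 1 (?P 0)"
    by simp
  then have "first_integral 1 (?P 6) = first_integral 1 (?P 0)"
    using levels in_N(1)[of 6] in_N(1)[of 0] by blast
  then have "a 6 = a 0"
    by (simp only: R)
  moreover have "\<bar>a 6\<bar> < \<bar>a 0\<bar>"
    using lift_Suc_mono_less[of "\<lambda>n. - \<bar>a n\<bar>" 0 6] step(1) by simp
  ultimately show False
    by simp
qed

theorem theorem4p3:
  shows "\<exists>(U :: plane set) (W :: 3 \<Rightarrow> foliation) (M :: plane).
    planar_3web U W \<and> M \<in> U \<and> \<not> flat_near M W \<and> (\<exists>g. circular_symmetry_around M W g)"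
  using planar_3web_web zero_in_square not_flat_web circular_symmetry_shift by blast

end
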